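(* Let $G$ be a finite Abelian group and let $k$ be an integer with $1\le k\leq |G|$. Let $d_1$ be the largest divisor of $|G|$ which is less than or equal to $k$ and let $d_2$ be the smallest divisor of $|G|$ which is larger than or equal to $k$. Then $$\phi(G,k)\ \geq\ \frac{|G|^2}{d_1d_2}\,(d_1+d_2-k).$$
   Context: For a finite set $A$, $\mathbb{C}^A$ is the space of functions $f:A\to\mathbb{C}$, and $\|f\|_0=|\{a\in A: f(a)\ne 0\}|$. For a finite Abelian group $G$ with dual group $\widehat G$ (the group of homomorphisms $\xi:G\to\{z\in\mathbb{C}:|z|=1\}$, $\langle\xi,x\rangle=\xi(x)$), the short-time Fourier transform of $f\in\mathbb{C}^G$ with respect to the window $g\in\mathbb{C}^G\setminus\{0\}$ is $V_gf\in\mathbb{C}^{G\times\widehat G}$, $V_gf(x,\xi)=\sum_{y\in G}f(y)\,\overline{g(y-x)}\,\overline{\langle\xi,y\rangle}$. For $1\le k\le|G|$ define $$\phi(G,k)=\max_{g\in\mathbb{C}^G\setminus\{0\}}\ \min\big\{\|V_gf\|_0:\ f\in\mathbb{C}^G,\ 0<\|f\|_0\le k\big\}.$$ *)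

theory Defs
  imports Complex_Main "HOL-Algebra.Coset"
begin

definition complex_funs :: "'a set \<Rightarrow> ('a \<Rightarrow> complex) set" where
  "complex_funs A = (A \<rightarrow>\<^sub>E UNIV)"

definition norm0 :: "'a set \<Rightarrow> ('a \<Rightarrow> complex) \<Rightarrow> nat" where
  "norm0 A f = card {a \<in> A. f a \<noteq> 0}"

definition circle_group :: "complex monoid" where
  "circle_group = \<lparr>carrier = {z. cmod z = 1}, mult = (*), one = 1\<rparr>"

(* Characters are taken extensional, so that each homomorphism on carrier G is counted once. *)
definition dual_group :: "('a, 'b) monoid_scheme \<Rightarrow> ('a \<Rightarrow> complex) monoid" where
  "dual_group G =
     \<lparr>carrier = hom G circle_group \<inter> extensional (carrier G),
      mult = (\<lambda>\<xi> \<eta>. \<lambda>x\<in>carrier G. \<xi> x * \<eta> x),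
      one = (\<lambda>x\<in>carrier G. 1)\<rparr>"

(* Groups are written multiplicatively here: y - x becomes y \<otimes> inv x. *)
definition stft ::
  "('a, 'b) monoid_scheme \<Rightarrow> ('a \<Rightarrow> complex) \<Rightarrow> ('a \<Rightarrow> complex)
     \<Rightarrow> ('a \<times> ('a \<Rightarrow> complex) \<Rightarrow> complex)" where
  "stft G g f =
     (\<lambda>(x, \<xi>)\<in>carrier G \<times> carrier (dual_group G).
        \<Sum>y\<in>carrier G. f y * cnj (g (y \<otimes>\<^bsub>G\<^esub> inv\<^bsub>G\<^esub> x)) * cnj (\<xi> y))"

(* For finite commutative G and 1 \<le> k \<le> order G, both sets below are nonempty, and finite because
   their members are natural numbers bounded by (order G)^2; so Min and Max are attained. *)
definition stft_phi :: "('a, 'b) monoid_scheme \<Rightarrow> nat \<Rightarrow> nat" where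
  "stft_phi G k =
     Max {Min {norm0 (carrier G \<times> carrier (dual_group G)) (stft G g f) | f.
                 f \<in> complex_funs (carrier G) \<and>
                 0 < norm0 (carrier G) f \<and> norm0 (carrier G) f \<le> k}
          | g. g \<in> complex_funs (carrier G) - {\<lambda>x\<in>carrier G. 0}}"

end

theory Submission
  imports Defs "HOL-Algebra.Multiplicative_Group"
    "HOL-Computational_Algebra.Polynomial" "HOL-Computational_Algebra.Primes"
begin

text \<open>
  For the constant window \<open>g = 1\<close> the short-time Fourier transform \<open>V\<^sub>g f(x, \<xi>)\<close> does not depend on
  \<open>x\<close> and is the Fourier transform of \<open>f\<close> at \<open>\<xi>\<close>, so its support has size \<open>|G|\<close> times that of the
  Fourier transform. The theorem therefore follows from Meshulam's uncertainty principle: if \<open>f\<close> is a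
  nonzero function on \<open>G\<close> with support of size \<open>s\<close>, and \<open>N\<close> is the size of the support of its Fourier
  transform, then the point \<open>(s, N)\<close> lies on or above the convex polygonal line through the points
  \<open>(D, |G|/D)\<close>, for the divisors \<open>D\<close> of \<open>|G|\<close>. This is stated through support functions: for all
  \<open>\<alpha>, \<beta> \<ge> 0\<close> there is a divisor \<open>D\<close> with \<open>\<alpha> D + \<beta> |G|/D \<le> \<alpha> s + \<beta> N\<close>
  (\<open>divisor_dominates\<close>). In this form the property is easily seen to be multiplicative
  (\<open>divisor_dominates_mult\<close>), and the choice \<open>\<alpha> = |G|\<close>, \<open>\<beta> = d\<^sub>1 d\<^sub>2\<close> gives the bound of the theorem
  (\<open>divisor_dominates_chord\<close>).

  The uncertainty principle is proved by enlarging a subgroup \<open>H\<close> of \<open>G\<close>, one prime index \<open>p\<close> at a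
  time. If \<open>y\<close> generates the larger group over \<open>H\<close>, a character \<open>\<eta>\<close> of \<open>H\<close> has \<open>p\<close> extensions, given
  by the \<open>p\<close>-th roots of \<open>\<eta>(y\<^sup>p)\<close>, and the Fourier transform of \<open>f\<close> at these is a Fourier transform
  over \<open>\<int>/p\<close> of the function \<open>j \<mapsto> c\<^sub>j\<close>, where \<open>c\<^sub>j\<close> is, up to a phase, the value at \<open>\<eta>\<close> of the
  Fourier transform of \<open>f\<close> on the coset \<open>H y\<^sup>j\<close>. Let \<open>t\<close> be the number of
  cosets on which \<open>f\<close> is not identically zero. On one of them the support of \<open>f\<close> has at most \<open>s/t\<close>
  elements; the result for \<open>H\<close>, applied to this coset, bounds from below the number of \<open>\<eta>\<close> for which \<open>c\<close> is not
  zero. By the result for \<open>\<int>/p\<close> each such \<open>\<eta>\<close> has at least \<open>p + 1 - t\<close> extensions at which the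
  Fourier transform of \<open>f\<close> is not zero (\<open>uncertainty_ext\<close>).

  For \<open>\<int>/p\<close> the two supports have sizes with sum at least \<open>p + 1\<close> (\<open>prime_uncertainty\<close>), a form of
  Chebotarev's theorem that all minors of the Fourier matrix are nonzero. The proof works in the finitely
  generated abelian group \<open>W\<close> spanned by all \<open>c\<^sub>j \<omega>\<^sup>t\<close>. If \<open>\<Sum>\<^sub>j c\<^sub>j Y\<^sup>j\<close> vanishes at as many powers of
  \<open>\<omega>\<close>, or more, as it has nonzero coefficients, then dividing out these roots shows that, up to integer factors
  prime to \<open>p\<close>, each \<open>c\<^sub>j\<close> lies in \<open>(1 - \<omega>)W\<close>. Since \<open>(1 - \<omega>)\<^sup>p\<close> maps \<open>W\<close> into \<open>pW\<close>, the
  group \<open>W\<close> equals \<open>pW\<close> up to such factors, and Nakayama's lemma over the integers gives \<open>W = 0\<close>.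
  Neither the irreducibility of the cyclotomic polynomial nor a reduction to algebraic coefficients is
  needed.
\<close>

section \<open>Nakayama's lemma for finitely generated groups of complex numbers\<close>

\<comment> \<open>In what follows \<open>order\<close> is the order of a group, not of a root.\<close>
hide_const (open) Polynomial.order

text \<open>The additive group of complex numbers, as a module over the integers.\<close>

interpretation int_mod: Modules.module "\<lambda>(n::int) (z::complex). of_int n * z"
  by unfold_locales (auto simp: algebra_simps)

text \<open>
  A finitely generated group \<open>M\<close> of complex numbers with \<open>M = pM\<close> is zero, and it suffices that
  this equation holds after inverting the integers \<open>m\<close> coprime to \<open>p\<close>. These factors are what allows a
  generator to be eliminated in the induction.
\<close>

lemma nakayama_int:
  fixes S :: "complex set" and p :: int
  assumes "finite S" and p: "\<not> p dvd 1"
    and "\<And>s. s \<in> S \<Longrightarrow> \<exists>m w. coprime m p \<and> w \<in> int_mod.span S \<and> of_int m * s = of_int p * w"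
  shows "\<forall>s\<in>S. s = 0"
  using assms(1,3)
proof (induction S)
  case empty
  then show ?case by simp
next
  case (insert s S)
  obtain m w where m: "coprime m p" and w: "w \<in> int_mod.span (insert s S)"
    and eq: "of_int m * s = of_int p * w"
    using insert.prems by blast
  obtain n where n: "w - of_int n * s \<in> int_mod.span S"
    using w by (auto simp: int_mod.span_breakdown_eq)
  define w' m' where "w' = w - of_int n * s" and "m' = m - p * n"
  have m': "coprime m' p"
  proof -
    have "gcd p (- n * p + m) = gcd p m" by (rule gcd_add_mult)
    then show ?thesis using m by (simp add: m'_def coprime_iff_gcd_eq_1 gcd.commute algebra_simps)
  qed
  have eq': "of_int m' * s = of_int p * w'"
    using eq by (simp add: m'_def w'_def algebra_simps)
  have "\<forall>t\<in>S. t = 0"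
  proof (rule insert.IH)
    fix t assume "t \<in> S"
    then obtain l v where l: "coprime l p" and v: "v \<in> int_mod.span (insert s S)"
      and eqt: "of_int l * t = of_int p * v"
      using insert.prems by blast
    obtain k where k: "v - of_int k * s \<in> int_mod.span S"
      using v by (auto simp: int_mod.span_breakdown_eq)
    have "of_int (m' * l) * t = of_int m' * (of_int p * v)"
      by (simp add: eqt[symmetric])
    also have "\<dots> = of_int p * (of_int m' * (v - of_int k * s) + of_int k * (of_int m' * s))"
      by (simp add: algebra_simps)
    also have "\<dots> = of_int p * (of_int m' * (v - of_int k * s) + of_int (k * p) * w')"
      by (simp add: eq')
    finally have "of_int (m' * l) * t = \<dots>" .
    moreover have "of_int m' * (v - of_int k * s) + of_int (k * p) * w' \<in> int_mod.span S"
      using k n unfolding w'_def by (intro int_mod.span_add int_mod.span_scale)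
    moreover have "coprime (m' * l) p" using m' l by simp
    ultimately show "\<exists>m w. coprime m p \<and> w \<in> int_mod.span S \<and> of_int m * t = of_int p * w"
      by blast
  qed
  moreover have "w' = 0"
  proof -
    have "S \<subseteq> {0}" using calculation by auto
    then have "w' \<in> int_mod.span {0}" using n int_mod.span_mono unfolding w'_def by blast
 then show ?thesis by (auto simp: int_mod.span_singleton)
  qed
  moreover have "m' \<noteq> 0" using m' p by auto
  ultimately show ?case using eq' by auto
qed

section \<open>Uncertainty principle for groups of prime order\<close>

text \<open>
  A group of complex numbers that is closed under multiplication by \<open>\<omega>\<close>, that is, a
  \<open>\<int>[\<omega>]\<close>-submodule of the complex numbers.
\<close>

locale int_power_module =
  fixes W :: "complex set" and \<omega> :: complex
  assumes zero_mem: "0 \<in> W"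
    and add_mem: "x \<in> W \<Longrightarrow> y \<in> W \<Longrightarrow> x + y \<in> W"
    and scale_mem: "x \<in> W \<Longrightarrow> of_int n * x \<in> W"
    and omega_mem: "x \<in> W \<Longrightarrow> \<omega> * x \<in> W"
begin

text \<open>The submodule \<open>(1 - \<omega>)W\<close>.\<close>

definition augW :: "complex set" where
  "augW = (\<lambda>w. (1 - \<omega>) * w) ` W"

lemma power_mem: "x \<in> W \<Longrightarrow> \<omega> ^ i * x \<in> W"
  by (induction i) (auto simp: mult.assoc omega_mem)

lemma sum_mem: "(\<And>i. i \<in> A \<Longrightarrow> f i \<in> W) \<Longrightarrow> sum f A \<in> W"
  by (induction A rule: infinite_finite_induct) (auto simp: zero_mem add_mem)

lemma augW_add: "x \<in> augW \<Longrightarrow> y \<in> augW \<Longrightarrow> x + y \<in> augW"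
  unfolding augW_def by (auto simp: distrib_left[symmetric] intro: add_mem)

lemma augW_zero: "0 \<in> augW"
  unfolding augW_def using zero_mem by force

lemma one_minus_power_augW:
  assumes "x \<in> W"
  shows "(1 - \<omega> ^ i) * x \<in> augW"
proof (induction i)
  case 0
  then show ?case by (simp add: augW_zero)
next
  case (Suc i)
  have "(1 - \<omega> ^ Suc i) * x = (1 - \<omega> ^ i) * x + (1 - \<omega>) * (\<omega> ^ i * x)"
    by (simp add: algebra_simps)
  moreover have "(1 - \<omega>) * (\<omega> ^ i * x) \<in> augW"
    using power_mem[OF assms] by (auto simp: augW_def)
  ultimately show ?case using Suc augW_add by metis
qed

lemma synthetic_div_mem:
  assumes "\<And>n. coeff g n \<in> W"
  shows "poly g (\<omega> ^ i) \<in> W \<and> (\<forall>n. coeff (synthetic_div g (\<omega> ^ i)) n \<in> W)"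
  using assms
proof (induction g)
  case 0
  then show ?case by (simp add: zero_mem)
next
  case (pCons a g)
  have "a \<in> W" using pCons.prems[of 0] by simp
  moreover have "\<And>n. coeff g n \<in> W" using pCons.prems[of "Suc _"] by simp
  ultimately show ?case using pCons.IH
    by (auto simp: coeff_pCons add_mem power_mem split: nat.split)
qed

text \<open>
  Modulo \<open>1 - \<omega>\<close> all powers of \<open>\<omega>\<close> are 1, so a polynomial vanishing on \<open>X\<close> behaves like a multiple
  of \<open>(Y - 1)\<^bsup>|X|\<^esup>\<close>: weighting its coefficients with a polynomial of degree less than \<open>|X|\<close> gives 0.
  Splitting off a factor \<open>Y - x\<close> amounts to replacing the weight \<open>P\<close> by its finite difference.
\<close>

lemma weighted_coeff_sum_augW:
  fixes P :: "int poly"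
  assumes "finite X" and "X \<subseteq> range (\<lambda>i. \<omega> ^ i)"
    and "P = 0 \<or> degree P < card X"
    and "\<And>n. coeff g n \<in> W" and "\<And>x. x \<in> X \<Longrightarrow> poly g x = 0"
    and "\<And>n. n > N \<Longrightarrow> coeff g n = 0"
  shows "(\<Sum>j\<le>N. of_int (poly P (int j)) * coeff g j) \<in> augW"
  using assms
proof (induction X arbitrary: P g)
  case empty
  then show ?case by (simp add: augW_zero)
next
  case (insert x X)
  obtain i where i: "x = \<omega> ^ i" using insert.prems by auto
  define h where "h = synthetic_div g x"
  have gh: "g = [:-x, 1:] * h"
    using synthetic_div_correct'[of x g] insert.prems(4)[of x] by (simp add: h_def)
  have hW: "coeff h n \<in> W" for n
    using synthetic_div_mem[of g i] insert.prems(3) by (simp add: h_def i)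
  have h0: "coeff h n = 0" if "n \<ge> N" for n
  proof (cases "g = 0")
    case False
    then have "h \<noteq> 0" using gh by auto
    then have "degree g = Suc (degree h)"
      using degree_mult_eq[of "[:-x, 1:]" h] gh by simp
    moreover have "degree g \<le> N" using insert.prems(5) by (intro degree_le) auto
    ultimately show ?thesis using that by (intro coeff_eq_0) auto
  qed (simp add: h_def)
  have hX: "poly h y = 0" if "y \<in> X" for y
  proof -
    have "poly g y = 0" "y \<noteq> x" using insert that by auto
    then show ?thesis by (simp add: gh)
  qed
  define D where "D = pcompose P [:1, 1:] - P"
  have D: "D = 0 \<or> degree D < card X"
  proof (cases "degree P = 0")
    case True
    then show ?thesis by (auto simp: D_def elim!: degree_eq_zeroE)
  next
    case False
    have "degree D < degree P"
    proof (rule le_neq_implies_less)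
      show "degree D \<le> degree P" unfolding D_def
        by (rule degree_diff_le) (auto simp: degree_pcompose)
      have "coeff D (degree P) = 0"
        using lead_coeff_comp[of "[:1,1:]" P] by (simp add: D_def degree_pcompose)
      then show "degree D \<noteq> degree P" using False leading_coeff_0_iff[of D] by force
    qed
    then show ?thesis using insert by auto
  qed
  have cg: "coeff g j = (if j = 0 then 0 else coeff h (j - 1)) - x * coeff h j" for j
    by (cases j) (simp_all add: gh)
  have "(\<Sum>j\<le>N. of_int (poly P (int j)) * coeff g j) =
        (\<Sum>j\<le>N. of_int (poly P (int j)) * (if j = 0 then 0 else coeff h (j - 1)))
        - x * (\<Sum>j\<le>N. of_int (poly P (int j)) * coeff h j)"
    by (simp add: cg algebra_simps sum_subtractf sum_distrib_left)
  also have "(\<Sum>j\<le>N. of_int (poly P (int j)) * (if j = 0 then 0 else coeff h (j - 1))) =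
        (\<Sum>j\<le>N. of_int (poly P (int j + 1)) * coeff h j)"
  proof (cases N)
    case 0
    then show ?thesis by (simp add: h0)
  next
    case (Suc M)
    have "(\<Sum>j\<le>N. of_int (poly P (int j)) * (if j = 0 then 0 else coeff h (j - 1))) =
        (\<Sum>j\<le>M. of_int (poly P (int j + 1)) * coeff h j)"
      unfolding Suc by (subst sum.atMost_Suc_shift) (simp add: add.commute)
    then show ?thesis by (simp add: Suc h0)
  qed
  also have "\<dots> - x * (\<Sum>j\<le>N. of_int (poly P (int j)) * coeff h j) =
      (\<Sum>j\<le>N. of_int (poly D (int j)) * coeff h j)
      + (1 - \<omega> ^ i) * (\<Sum>j\<le>N. of_int (poly P (int j)) * coeff h j)"
    by (simp add: D_def poly_pcompose algebra_simps sum_subtractf sum.distrib i)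
  also have "\<dots> \<in> augW"
  proof (rule augW_add)
    show "(\<Sum>j\<le>N. of_int (poly D (int j)) * coeff h j) \<in> augW"
      using insert.prems D hX hW h0 by (intro insert.IH) auto
    show "(1 - \<omega> ^ i) * (\<Sum>j\<le>N. of_int (poly P (int j)) * coeff h j) \<in> augW"
      by (intro one_minus_power_augW sum_mem scale_mem hW)
  qed
  finally show ?case .
qed

text \<open>Multiplication by \<open>(1 - \<omega>)\<^sup>p\<close> maps \<open>W\<close> into \<open>pW\<close>, by the binomial theorem.\<close>

lemma one_minus_omega_power_prime:
  fixes p :: nat
  assumes "prime p" and "\<omega> ^ p = 1" and "w \<in> W"
  shows "\<exists>v\<in>W. (1 - \<omega>) ^ p * w = of_nat p * v"
proof -
  have term_i: "\<exists>v\<in>W. of_nat (p choose i) * (-\<omega>) ^ i * w = of_nat p * v" if "i \<in> {1..<p}" for i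
  proof -
    have "p dvd (p choose i)" using that assms(1) by (intro dvd_choose_prime) auto
    then obtain q where "p choose i = p * q" by (auto elim: dvdE)
    then have "of_nat (p choose i) * (-\<omega>) ^ i * w
        = of_nat p * (of_int (int q * (-1) ^ i) * (\<omega> ^ i * w))"
      by (simp add: power_minus[of \<omega>] mult_ac)
    then show ?thesis using scale_mem power_mem assms(3) by blast
  qed
  then obtain v where v: "\<And>i. i \<in> {1..<p} \<Longrightarrow> v i \<in> W"
    "\<And>i. i \<in> {1..<p} \<Longrightarrow> of_nat (p choose i) * (-\<omega>) ^ i * w = of_nat p * v i"
    by metis
  have p2: "p \<ge> 2" using assms(1) by (rule prime_ge_2_nat)
  have ends: "\<exists>u\<in>W. (1 + (-\<omega>) ^ p) * w = of_nat p * u"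
  proof (cases "p = 2")
    case True
    then show ?thesis using assms by (intro bexI[of _ w]) auto
  next
    case False
    then have "odd p" using assms(1) p2 prime_odd_nat[of p] by auto
    then show ?thesis using assms zero_mem by (intro bexI[of _ 0]) (auto simp: power_minus_odd)
  qed
  then obtain u where u: "u \<in> W" "(1 + (-\<omega>) ^ p) * w = of_nat p * u" by blast
  have "(1 - \<omega>) ^ p = (\<Sum>i\<le>p. of_nat (p choose i) * (-\<omega>) ^ i)"
    using binomial_ring[of "-\<omega>" 1 p] by simp
  also have "{..p} = insert 0 (insert p {1..<p})" using p2 by auto
  also have "(\<Sum>i\<in>insert 0 (insert p {1..<p}). of_nat (p choose i) * (-\<omega>) ^ i)
      = (1 + (-\<omega>) ^ p) + (\<Sum>i\<in>{1..<p}. of_nat (p choose i) * (-\<omega>) ^ i)"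
    using p2 by simp
  finally have "(1 - \<omega>) ^ p * w = of_nat p * u + (\<Sum>i\<in>{1..<p}. of_nat p * v i)"
    using u(2) by (simp add: distrib_right sum_distrib_right v(2))
  then have "(1 - \<omega>) ^ p * w = of_nat p * (u + (\<Sum>i\<in>{1..<p}. v i))"
    by (simp add: distrib_left sum_distrib_left)
  then show ?thesis using u(1) v(1) by (blast intro: add_mem sum_mem)
qed

end

lemma root_of_unity_power_inj:
  fixes \<omega> :: complex and p :: nat
  assumes "prime p" and "\<omega> ^ p = 1" and "\<omega> \<noteq> 1"
  shows "inj_on (\<lambda>i. \<omega> ^ i) {..<p}"
proof -
  have *: False if "i < j" "j < p" "\<omega> ^ i = \<omega> ^ j" for i j
  proof -
    have "\<omega> \<noteq> 0" using assms by (auto simp: power_0_left split: if_splits)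
    then have d1: "\<omega> ^ (j - i) = 1" using that by (simp add: power_diff)
    have "coprime (j - i) p"
      using that assms(1) by (metis coprime_commute less_imp_diff_less nat_dvd_not_less prime_imp_coprime zero_less_diff)
    then obtain x y where "(j - i) * x = p * y + 1"
      using coprime_bezout_strong[of "j - i" p] assms(1) prime_gt_1_nat by (metis not_less_iff_gr_or_eq)
    then have "\<omega> ^ ((j - i) * x) = \<omega> ^ (p * y) * \<omega>" by simp
    then show False using d1 assms by (simp add: power_mult)
  qed
  show ?thesis
  proof (rule inj_onI)
    fix i j assume "i \<in> {..<p}" "j \<in> {..<p}" "\<omega> ^ i = \<omega> ^ j"
    then show "i = j" using *[of i j] *[of j i] by (metis lessThan_iff linorder_neqE_nat)
  qed
qed

text \<open>
  The supports of a nonzero function \<open>c\<close> on \<open>\<int>/p\<close> and of its Fourier transform are compared. Both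
  \<open>\<int>/p\<close> and its dual are represented by the numbers below \<open>p\<close>, through an arbitrary nontrivial
  \<open>p\<close>-th root of unity \<open>\<omega>\<close>.
\<close>

theorem prime_uncertainty:
  fixes c :: "nat \<Rightarrow> complex" and \<omega> :: complex and p :: nat
  assumes p: "prime p" and \<omega>: "\<omega> ^ p = 1" "\<omega> \<noteq> 1" and nz: "\<exists>j<p. c j \<noteq> 0"
  shows "p + 1 \<le> card {j. j < p \<and> c j \<noteq> 0} + card {i. i < p \<and> (\<Sum>j<p. c j * \<omega> ^ (i * j)) \<noteq> 0}"
proof (rule ccontr)
  define J where "J = {j. j < p \<and> c j \<noteq> 0}"
  define Z where "Z = {i. i < p \<and> (\<Sum>j<p. c j * \<omega> ^ (i * j)) = 0}"
  assume contr: "\<not> ?thesis"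
  have "card {..<p} = card (Z \<union> {i. i < p \<and> (\<Sum>j<p. c j * \<omega> ^ (i * j)) \<noteq> 0})"
    by (rule arg_cong[of _ _ card]) (auto simp: Z_def)
  also have "\<dots> = card Z + card {i. i < p \<and> (\<Sum>j<p. c j * \<omega> ^ (i * j)) \<noteq> 0}"
    by (rule card_Un_disjoint) (auto simp: Z_def)
  finally have JZ: "card J \<le> card Z" using contr by (simp add: J_def)
  define X where "X = (\<lambda>i. \<omega> ^ i) ` Z"
  have cardX: "card X = card Z" unfolding X_def
    by (rule card_image, rule inj_on_subset[OF root_of_unity_power_inj[OF p \<omega>]]) (auto simp: Z_def)
  define S where "S = (\<lambda>(j, t). c j * \<omega> ^ t) ` ({..<p} \<times> {..<p})"
  define W where "W = int_mod.span S"
  have p0: "p > 0" using p by (simp add: prime_gt_0_nat)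
  have cS: "c j * \<omega> ^ t \<in> W" if "j < p" for j t
  proof -
    have "\<omega> ^ t = \<omega> ^ (t mod p)"
      using \<omega>(1) by (metis mult_1 mult_div_mod_eq power_add power_mult power_one)
    then have "c j * \<omega> ^ t \<in> S" using that p0 unfolding S_def by (auto intro!: image_eqI[of _ _ "(j, t mod p)"])
    then show ?thesis unfolding W_def by (rule int_mod.span_base)
  qed
  interpret int_power_module W \<omega>
  proof
    fix x assume "x \<in> W"
    then show "\<omega> * x \<in> W" unfolding W_def
    proof (induction rule: int_mod.span_induct_alt)
      case base
      then show ?case by (simp add: int_mod.span_zero)
    next
      case (step n s y)
      obtain j t where s: "s = c j * \<omega> ^ t" "j < p" using step by (auto simp: S_def)
      have "\<omega> * s \<in> int_mod.span S" using cS[OF s(2), of "Suc t"] by (simp add: W_def s mult_ac)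
      then have "of_int n * (\<omega> * s) + \<omega> * y \<in> int_mod.span S"
        using step by (intro int_mod.span_add int_mod.span_scale) auto
      then show ?case by (simp add: algebra_simps)
    qed
  qed (auto simp: W_def int_mod.span_zero intro: int_mod.span_add int_mod.span_scale)
  define g where "g = (\<Sum>j<p. monom (c j) j)"
  have cg: "coeff g n = (if n < p then c n else 0)" for n
    by (simp add: g_def coeff_sum if_distrib cong: if_cong)
  have gX: "poly g x = 0" if "x \<in> X" for x
    using that by (auto simp: X_def Z_def g_def poly_sum poly_monom power_mult)
  have gen: "\<exists>m. coprime m (int p) \<and> of_int m * c j \<in> augW" if "j < p" for j
  proof (cases "c j = 0")
    case True
    then show ?thesis by (intro exI[of _ 1]) (simp add: augW_zero)
  next
    case False
    \<comment> \<open>A weight that vanishes on the support of \<open>c\<close> except at \<open>j\<close>, where its value is prime to \<open>p\<close>.\<close>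
    define P :: "int poly" where "P = (\<Prod>i\<in>J - {j}. [:- int i, 1:])"
    have PJ: "poly P x = (\<Prod>i\<in>J - {j}. x - int i)" for x by (simp add: P_def poly_prod)
    have J: "finite J" "j \<in> J" using that False by (auto simp: J_def)
    have "degree P \<le> sum (degree \<circ> (\<lambda>i. [:- int i, 1:])) (J - {j})"
      unfolding P_def by (rule degree_prod_sum_le) (use J in auto)
    also have "\<dots> = card J - 1" using J by simp
    also have "\<dots> < card J" using J by (metis card_gt_0_iff diff_less empty_iff zero_less_one)
    finally have "(\<Sum>i\<le>p. of_int (poly P (int i)) * coeff g i) \<in> augW"
      \<comment> \<open>The weight has degree \<open>|J| - 1\<close>, and \<open>g\<close> has at least \<open>|J|\<close> roots in \<open>X\<close>.\<close>
      using gX cS[of _ 0] JZ cardX zero_mem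
      by (intro weighted_coeff_sum_augW[of X]) (auto simp: cg X_def Z_def)
    also have "(\<Sum>i\<le>p. of_int (poly P (int i)) * coeff g i)
        = (\<Sum>i\<in>{j}. of_int (poly P (int i)) * coeff g i)"
    proof (rule sum.mono_neutral_right)
      show "\<forall>i\<in>{..p} - {j}. of_int (poly P (int i)) * coeff g i = 0"
      proof
        fix i assume i: "i \<in> {..p} - {j}"
        show "of_int (poly P (int i)) * coeff g i = 0"
        proof (cases "i \<in> J")
          case True
          then have "poly P (int i) = 0" using i J by (auto simp: PJ)
          then show ?thesis by simp
        qed (auto simp: cg J_def)
      qed
    qed (use that in auto)
    finally have "of_int (poly P (int j)) * c j \<in> augW" using that by (simp add: cg)
    moreover have "coprime (poly P (int j)) (int p)" unfolding PJ
    proof (rule prod_coprime_left)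
      fix i assume "i \<in> J - {j}"
      then have "0 < \<bar>int j - int i\<bar>" "\<bar>int j - int i\<bar> < int p" using that by (auto simp: J_def)
      then have "\<not> int p dvd (int j - int i)" using zdvd_not_zless[of "\<bar>int j - int i\<bar>" "int p"] by simp
      then show "coprime (int j - int i) (int p)"
        using p by (subst coprime_commute, intro prime_imp_coprime) auto
    qed
    ultimately show ?thesis by blast
  qed
  have step1: "\<exists>m v. coprime m (int p) \<and> v \<in> W \<and> of_int m * w = (1 - \<omega>) * v" if "w \<in> W" for w
    using that unfolding W_def
  proof (induction rule: int_mod.span_induct_alt)
    case base
    show ?case by (intro exI[of _ 1] exI[of _ 0]) (simp add: int_mod.span_zero)
  next
    case (step n s y)
    obtain j t where s: "s = c j * \<omega> ^ t" "j < p" using step by (auto simp: S_def)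
    obtain m u where m: "coprime m (int p)" "u \<in> W" "of_int m * c j = (1 - \<omega>) * u"
      using gen[OF s(2)] by (auto simp: augW_def)
    obtain l v where l: "coprime l (int p)" "v \<in> W" "of_int l * y = (1 - \<omega>) * v"
      using step by (auto simp: W_def)
    have "of_int (m * l) * (of_int n * s + y) =
       of_int (l * n) * \<omega> ^ t * (of_int m * c j) + of_int m * (of_int l * y)"
      by (simp only: s(1) of_int_mult ring_distribs mult_ac)
    also have "\<dots> = (1 - \<omega>) * (of_int (l * n) * (\<omega> ^ t * u) + of_int m * v)"
      unfolding m(3) l(3) by (simp only: of_int_mult ring_distribs mult_ac)
    finally have "of_int (m * l) * (of_int n * s + y) = \<dots>" .
    moreover have "of_int (l * n) * (\<omega> ^ t * u) + of_int m * v \<in> W"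
      using m l by (intro add_mem scale_mem power_mem)
    moreover have "coprime (m * l) (int p)" using m l by simp
    ultimately show ?case unfolding W_def by blast
  qed
  \<comment> \<open>Iterating, up to the exponent \<open>p\<close> that is needed to reach \<open>pW\<close>.\<close>
  have stepk: "\<exists>m v. coprime m (int p) \<and> v \<in> W \<and> of_int m * w = (1 - \<omega>) ^ k * v" if "w \<in> W" for w k
  proof (induction k)
    case 0
    show ?case using that by (intro exI[of _ 1] exI[of _ w]) simp
  next
    case (Suc k)
    then obtain m v where m: "coprime m (int p)" "v \<in> W" "of_int m * w = (1 - \<omega>) ^ k * v" by blast
    obtain l u where l: "coprime l (int p)" "u \<in> W" "of_int l * v = (1 - \<omega>) * u"
      using step1[OF m(2)] by blast
    have "of_int (l * m) * w = of_int l * ((1 - \<omega>) ^ k * v)" by (simp add: m(3)[symmetric])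
    also have "\<dots> = (1 - \<omega>) ^ k * (of_int l * v)" by (simp add: mult_ac)
    also have "\<dots> = (1 - \<omega>) ^ Suc k * u" unfolding l(3) by (simp only: power_Suc mult_ac)
    finally show ?case using m l by (intro exI[of _ "l * m"] exI[of _ u]) simp
  qed
  have "\<forall>s\<in>S. s = 0"
  proof (rule nakayama_int[where p = "int p"])
    show "finite S" by (simp add: S_def)
    show "\<not> int p dvd 1" using p by auto
    fix s assume "s \<in> S"
    then have "s \<in> W" by (simp add: W_def int_mod.span_base)
    then obtain m v where m: "coprime m (int p)" "v \<in> W" "of_int m * s = (1 - \<omega>) ^ p * v"
      using stepk by blast
    moreover obtain u where "u \<in> W" "(1 - \<omega>) ^ p * v = of_nat p * u"
      using one_minus_omega_power_prime[OF p \<omega>(1) m(2)] by blast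
    ultimately show "\<exists>m w. coprime m (int p) \<and> w \<in> int_mod.span S \<and> of_int m * s = of_int (int p) * w"
      by (intro exI[of _ m] exI[of _ u]) (simp add: W_def)
  qed
  moreover have "c j * \<omega> ^ 0 \<in> S" if "j < p" for j
    using that p0 unfolding S_def by (intro image_eqI[of _ _ "(j, 0)"]) auto
  ultimately show False using nz by auto
qed

section \<open>Points above the polygonal line of the divisors\<close>

text \<open>
  The point \<open>(x, y)\<close> lies in the sum of the convex hull of all \<open>(D, n/D)\<close>, \<open>D\<close> a divisor of \<open>n\<close>, and
  the nonnegative quadrant (for \<open>n > 0\<close>). Membership is expressed by the linear functionals with nonnegative coefficients.
\<close>

definition divisor_dominates :: "nat \<Rightarrow> real \<Rightarrow> real \<Rightarrow> bool" where
  "divisor_dominates n x y \<longleftrightarrow>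
     (\<forall>\<alpha>\<ge>0. \<forall>\<beta>\<ge>0. \<exists>D. D dvd n \<and> \<alpha> * real D + \<beta> * (real n / real D) \<le> \<alpha> * x + \<beta> * y)"

lemma divisor_dominates_mono:
  assumes "divisor_dominates n x y" and "x \<le> x'" and "y \<le> y'"
  shows "divisor_dominates n x' y'"
  unfolding divisor_dominates_def
proof (intro allI impI)
  fix \<alpha> \<beta> :: real assume nonneg: "\<alpha> \<ge> 0" "\<beta> \<ge> 0"
  then obtain D where "D dvd n" "\<alpha> * real D + \<beta> * (real n / real D) \<le> \<alpha> * x + \<beta> * y"
    using assms(1) unfolding divisor_dominates_def by blast
  moreover have "\<alpha> * x + \<beta> * y \<le> \<alpha> * x' + \<beta> * y'"
    using nonneg assms by (intro add_mono mult_left_mono)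
  ultimately show "\<exists>D. D dvd n \<and> \<alpha> * real D + \<beta> * (real n / real D) \<le> \<alpha> * x' + \<beta> * y'"
    by (blast intro: order_trans)
qed

lemma divisor_dominates_mult:
  assumes a: "divisor_dominates a x1 y1" and b: "divisor_dominates b x2 y2"
    and nonneg: "0 \<le> x2" "0 \<le> y2"
  shows "divisor_dominates (a * b) (x1 * x2) (y1 * y2)"
  unfolding divisor_dominates_def
proof (intro allI impI)
  fix \<alpha> \<beta> :: real assume \<alpha>: "\<alpha> \<ge> 0" and \<beta>: "\<beta> \<ge> 0"
  \<comment> \<open>The first coordinates are varied with the second ones as weights, then vice versa.\<close>
  obtain D where D: "D dvd a" "(\<alpha> * x2) * real D + (\<beta> * y2) * (real a / real D) \<le> (\<alpha> * x2) * x1 + (\<beta> * y2) * y1"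
    using a \<alpha> \<beta> nonneg unfolding divisor_dominates_def by (meson mult_nonneg_nonneg)
  have "0 \<le> \<alpha> * real D" "0 \<le> \<beta> * (real a / real D)" using \<alpha> \<beta> by simp_all
  then obtain E where E: "E dvd b" "(\<alpha> * real D) * real E + (\<beta> * (real a / real D)) * (real b / real E)
      \<le> (\<alpha> * real D) * x2 + (\<beta> * (real a / real D)) * y2"
    using b unfolding divisor_dominates_def by meson
  have "\<alpha> * real (D * E) + \<beta> * (real (a * b) / real (D * E)) \<le> \<alpha> * (x1 * x2) + \<beta> * (y1 * y2)"
    using D(2) E(2) by (simp add: mult_ac)
  then show "\<exists>F. F dvd a * b \<and> \<alpha> * real F + \<beta> * (real (a * b) / real F) \<le> \<alpha> * (x1 * x2) + \<beta> * (y1 * y2)"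
    using D(1) E(1) mult_dvd_mono by blast
qed

lemma divisor_dominates_prime:
  fixes p s :: nat
  assumes "prime p" and "1 \<le> s" and "s \<le> p"
  shows "divisor_dominates p (real s) (real (p + 1 - s))"
  unfolding divisor_dominates_def
proof (intro allI impI)
  fix \<alpha> \<beta> :: real assume "\<alpha> \<ge> 0" "\<beta> \<ge> 0"
  have ps: "real (p + 1 - s) = real p + 1 - real s" using assms by simp
  show "\<exists>D. D dvd p \<and> \<alpha> * real D + \<beta> * (real p / real D) \<le> \<alpha> * real s + \<beta> * real (p + 1 - s)"
  proof (cases "\<beta> \<le> \<alpha>")
    case True
    then have "0 \<le> (\<alpha> - \<beta>) * (real s - 1)" using assms by (intro mult_nonneg_nonneg) auto
    then show ?thesis unfolding ps by (intro exI[of _ 1]) (simp add: algebra_simps)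
  next
    case False
    then have "0 \<le> (\<beta> - \<alpha>) * (real p - real s)" using assms by (intro mult_nonneg_nonneg) auto
    moreover have "p > 0" using assms by (simp add: prime_gt_0_nat)
    ultimately show ?thesis unfolding ps by (intro exI[of _ p]) (simp add: algebra_simps)
  qed
qed

text \<open>
  The points \<open>(D, n/D)\<close> are all on or above the line through \<open>(d, n/d)\<close> and \<open>(d', n/d')\<close>, because \<open>D\<close> is
  not strictly between \<open>d\<close> and \<open>d'\<close>. For \<open>d = d'\<close> the line is the tangent to the hyperbola.
\<close>

lemma divisor_dominates_chord:
  assumes dom: "divisor_dominates n x y" and "n > 0"
    and gap: "\<And>D. D dvd n \<Longrightarrow> D \<le> d \<or> d' \<le> D" and "d \<le> d'"
  shows "real n * (real d + real d') \<le> real n * x + real d * real d' * y"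
proof -
  obtain D where D: "D dvd n"
    and le: "real n * real D + real d * real d' * (real n / real D) \<le> real n * x + real d * real d' * y"
    using dom unfolding divisor_dominates_def by (meson mult_nonneg_nonneg of_nat_0_le_iff)
  have D0: "real D > 0" using D \<open>n > 0\<close> by (auto intro: dvd_pos_nat)
  have "0 \<le> (real D - real d) * (real D - real d')"
  proof (cases "D \<le> d")
    case True
    then show ?thesis using \<open>d \<le> d'\<close> by (intro mult_nonpos_nonpos) auto
  next
    case False
    then show ?thesis using gap[OF D] by (intro mult_nonneg_nonneg) auto
  qed
  then have "0 \<le> real n / real D * ((real D - real d) * (real D - real d'))"
    by (rule mult_nonneg_nonneg[rotated]) simp
  also have "\<dots> = real n * real D + real d * real d' * (real n / real D) - real n * (real d + real d')"
    using D0 by (simp add: field_simps)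
  finally show ?thesis using le by linarith
qed

section \<open>Characters of subgroups\<close>

text \<open>
  The characters of a subgroup \<open>H\<close>, given by its carrier and extensional on it, so that each is
  counted once.
\<close>

definition characters_on :: "('a, 'b) monoid_scheme \<Rightarrow> 'a set \<Rightarrow> ('a \<Rightarrow> complex) set" where
  "characters_on G H = {\<chi> \<in> extensional H.
     (\<forall>a\<in>H. \<forall>b\<in>H. \<chi> (a \<otimes>\<^bsub>G\<^esub> b) = \<chi> a * \<chi> b) \<and> (\<forall>a\<in>H. cmod (\<chi> a) = 1)}"

text \<open>The Fourier transform on \<open>H\<close>, at the character \<open>\<chi>\<close>.\<close>

definition fourier_on :: "'a set \<Rightarrow> ('a \<Rightarrow> complex) \<Rightarrow> ('a \<Rightarrow> complex) \<Rightarrow> complex" where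
  "fourier_on H f \<chi> = (\<Sum>h\<in>H. f h * cnj (\<chi> h))"

text \<open>Meshulam's uncertainty principle for the subgroup \<open>H\<close>.\<close>

definition uncertainty_on :: "('a, 'b) monoid_scheme \<Rightarrow> 'a set \<Rightarrow> bool" where
  "uncertainty_on G H \<longleftrightarrow> (\<forall>f. (\<exists>h\<in>H. f h \<noteq> 0) \<longrightarrow>
     divisor_dominates (card H) (real (card {h \<in> H. f h \<noteq> 0}))
       (real (card {\<chi> \<in> characters_on G H. fourier_on H f \<chi> \<noteq> 0})))"

lemma carrier_dual_group: "carrier (dual_group G) = characters_on G (carrier G)"
  by (auto simp: dual_group_def characters_on_def hom_def circle_group_def)

context group
begin

lemma subgroup_nat_pow_mem:
  assumes "subgroup H G" and "a \<in> H"
  shows "a [^] (n::nat) \<in> H"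
  by (induction n) (use assms in \<open>simp_all add: subgroup.m_closed subgroup.one_closed\<close>)

lemma character_one:
  assumes "subgroup H G" and "\<chi> \<in> characters_on G H"
  shows "\<chi> \<one> = 1"
proof -
  have 1: "\<one> \<in> H" using assms(1) by (rule subgroup.one_closed)
  then have "\<chi> (\<one> \<otimes> \<one>) = \<chi> \<one> * \<chi> \<one>" and "cmod (\<chi> \<one>) = 1"
    using assms(2) unfolding characters_on_def by blast+
  then show ?thesis by auto
qed

lemma character_nat_pow:
  assumes "subgroup H G" and "\<chi> \<in> characters_on G H" and "a \<in> H"
  shows "\<chi> (a [^] (n::nat)) = \<chi> a ^ n"
proof (induction n)
  case 0
  then show ?case using character_one[OF assms(1,2)] by simp
next
  case (Suc n)
  have "\<chi> (a [^] n \<otimes> a) = \<chi> (a [^] n) * \<chi> a"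
    using subgroup_nat_pow_mem[OF assms(1,3)] assms(2,3) by (auto simp: characters_on_def)
  then show ?case using Suc by simp
qed

lemma finite_characters_on:
  assumes "finite (carrier G)" and "subgroup H G"
  shows "finite (characters_on G H)"
proof (rule finite_subset)
  have HG: "H \<subseteq> carrier G" using assms(2) by (rule subgroup.subset)
  have n: "order G > 0" using assms(1) by (simp add: order_gt_0_iff_finite)
  show "characters_on G H \<subseteq> H \<rightarrow>\<^sub>E {z. z ^ order G = 1}"
  proof
    fix \<chi> assume \<chi>: "\<chi> \<in> characters_on G H"
    have "\<chi> a ^ order G = 1" if "a \<in> H" for a
      using character_nat_pow[OF assms(2) \<chi> that, of "order G"] character_one[OF assms(2) \<chi>]
        pow_order_eq_1[of a] that HG by auto
    then show "\<chi> \<in> H \<rightarrow>\<^sub>E {z. z ^ order G = 1}"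
      using \<chi> by (auto simp: characters_on_def PiE_def)
  qed
  show "finite (H \<rightarrow>\<^sub>E {z::complex. z ^ order G = 1})"
    using n finite_subset[OF HG assms(1)] by (intro finite_PiE finite_roots_unity) auto
qed

end

section \<open>Enlarging a subgroup by a prime index\<close>

text \<open>
  The class of \<open>y\<close> modulo \<open>H\<close> has order \<open>p\<close>.
\<close>

locale prime_cyclic_extension = comm_group G for G :: "('a, 'b) monoid_scheme" (structure) +
  fixes H :: "'a set" and p :: nat and y :: 'a
  assumes finite_G: "finite (carrier G)"
    and H: "subgroup H G"
    and p: "prime p"
    and y: "y \<in> carrier G"
    and ypH: "y [^] p \<in> H"
    and yjH: "0 < j \<Longrightarrow> j < p \<Longrightarrow> y [^] j \<notin> H"
begin

text \<open>
  The subgroup generated by \<open>H\<close> and \<open>y\<close>, as the disjoint union of the cosets \<open>H y\<^sup>j\<close> for \<open>j < p\<close>.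
\<close>

definition ext :: "'a set" where
  "ext = (\<lambda>(h, j). h \<otimes> y [^] j) ` (H \<times> {..<p})"

lemma p0: "p > 0"
  using p by (rule prime_gt_0_nat)

lemma HG: "h \<in> H \<Longrightarrow> h \<in> carrier G"
  using H by (rule subgroup.mem_carrier)

lemma finite_H: "finite H"
  using finite_subset[OF subgroup.subset[OF H] finite_G] .

lemma inj_ext: "inj_on (\<lambda>(h, j). h \<otimes> y [^] j) (H \<times> {..<p})"
proof -
  have *: "i \<ge> j" if "h \<in> H" "h' \<in> H" "i < p" "j < p" "h \<otimes> y [^] i = h' \<otimes> y [^] j" for h h' i j
  proof (rule ccontr)
    assume "\<not> i \<ge> j"
    then have ij: "y [^] j = y [^] (j - i) \<otimes> y [^] i" using y by (simp add: nat_pow_mult)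
    have "h \<otimes> y [^] i = (h' \<otimes> y [^] (j - i)) \<otimes> y [^] i"
      using that HG y by (simp add: ij m_assoc)
    then have "h = h' \<otimes> y [^] (j - i)" using that HG y by simp
    then have "y [^] (j - i) = inv h' \<otimes> h" using that HG y by (simp add: inv_solve_left)
    then have "y [^] (j - i) \<in> H"
      using that H by (simp add: subgroup.m_closed subgroup.m_inv_closed)
    then show False using yjH[of "j - i"] that \<open>\<not> i \<ge> j\<close> by simp
  qed
  show ?thesis
  proof (rule inj_onI, clarify)
    fix h h' i j assume a: "h \<in> H" "h' \<in> H" "i < p" "j < p" "h \<otimes> y [^] i = h' \<otimes> y [^] j"
    then have "i = j" using *[of h h' i j] *[of h' h j i] by simp
    then show "h = h' \<and> i = j" using a HG y by simp
  qed
qed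

lemma card_ext: "card ext = card H * p"
  unfolding ext_def by (simp add: card_image[OF inj_ext] card_cartesian_product)

lemma sum_ext: "(\<Sum>z\<in>ext. F z) = (\<Sum>j<p. \<Sum>h\<in>H. F (h \<otimes> y [^] j))"
proof -
  have "(\<Sum>z\<in>ext. F z) = (\<Sum>(h, j)\<in>H \<times> {..<p}. F (h \<otimes> y [^] j))"
    unfolding ext_def by (subst sum.reindex[OF inj_ext]) (simp add: case_prod_unfold comp_def)
  also have "\<dots> = (\<Sum>h\<in>H. \<Sum>j<p. F (h \<otimes> y [^] j))"
    by (rule sum.cartesian_product[symmetric])
  also have "\<dots> = (\<Sum>j<p. \<Sum>h\<in>H. F (h \<otimes> y [^] j))"
    by (rule sum.swap)
  finally show ?thesis .
qed

lemma ext_reduce: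
  assumes "h \<in> H"
  shows "h \<otimes> y [^] j = (h \<otimes> (y [^] p) [^] (j div p)) \<otimes> y [^] (j mod p)"
    and "h \<otimes> (y [^] p) [^] (j div p) \<in> H"
proof -
  have "y [^] j = (y [^] p) [^] (j div p) \<otimes> y [^] (j mod p)"
    using y by (simp add: nat_pow_pow nat_pow_mult)
  then show "h \<otimes> y [^] j = (h \<otimes> (y [^] p) [^] (j div p)) \<otimes> y [^] (j mod p)"
    using assms HG y by (simp add: m_assoc)
  show "h \<otimes> (y [^] p) [^] (j div p) \<in> H"
    using subgroup.m_closed[OF H assms subgroup_nat_pow_mem[OF H ypH]] .
qed

lemma ext_mem: "h \<in> H \<Longrightarrow> h \<otimes> y [^] (j::nat) \<in> ext"
  using ext_reduce[of h j] p0 unfolding ext_def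
  by (auto intro!: image_eqI[of _ _ "(h \<otimes> (y [^] p) [^] (j div p), j mod p)"])

lemma ext_mult:
  assumes "h \<in> H" "h' \<in> H"
  shows "(h \<otimes> y [^] (i::nat)) \<otimes> (h' \<otimes> y [^] (j::nat)) = (h \<otimes> h') \<otimes> y [^] (i + j)"
proof -
  have "y [^] (i + j) = y [^] i \<otimes> y [^] j" using y by (simp add: nat_pow_mult)
  then show ?thesis using assms HG y by (simp add: m_ac)
qed

lemma ext_cases:
  assumes "a \<in> ext"
  obtains h j where "h \<in> H" "j < p" "a = h \<otimes> y [^] (j::nat)"
  using assms unfolding ext_def by auto

lemma subgroup_ext: "subgroup ext G"
proof (rule subgroupI)
  show "ext \<subseteq> carrier G" using HG y by (auto simp: ext_def)
  show "ext \<noteq> {}" using ext_mem[of \<one> 0] subgroup.one_closed[OF H] by auto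
next
  fix a assume "a \<in> ext"
  then obtain h j where a: "a = h \<otimes> y [^] j" "h \<in> H" "j < p" by (auto simp: ext_def)
  define h' where "h' = inv h \<otimes> inv (y [^] p)"
  have h': "h' \<in> H" using a ypH H by (simp add: h'_def subgroup.m_closed subgroup.m_inv_closed)
  have "a \<otimes> (h' \<otimes> y [^] (p - j)) = (h \<otimes> h') \<otimes> y [^] p"
    using a ext_mult[OF a(2) h', of j "p - j"] by simp
  also have "\<dots> = (h \<otimes> inv h) \<otimes> (inv (y [^] p) \<otimes> y [^] p)"
    using a HG y by (simp add: h'_def m_assoc)
  also have "\<dots> = \<one>" using a HG y by simp
  finally have "inv a = h' \<otimes> y [^] (p - j)"
    using a h' HG y by (metis inv_equality m_comm m_closed nat_pow_closed)
  then show "inv a \<in> ext" using ext_mem[OF h'] by simp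
next
  fix a b assume "a \<in> ext" "b \<in> ext"
  then obtain h i h' j where "a = h \<otimes> y [^] (i::nat)" "h \<in> H" "b = h' \<otimes> y [^] (j::nat)" "h' \<in> H"
    by (metis ext_cases)
  then show "a \<otimes> b \<in> ext"
    using ext_mult[of h h' i j] ext_mem[of "h \<otimes> h'" "i + j"] H by (simp add: subgroup.m_closed)
qed

lemma H_subset_ext: "H \<subseteq> ext"
  using ext_mem[of _ 0] HG by force

lemma y_mem_ext: "y \<in> ext"
  using ext_mem[of \<one> 1] subgroup.one_closed[OF H] y by simp

text \<open>
  The extension of the character \<open>\<eta>\<close> of \<open>H\<close> that takes the value \<open>\<zeta>\<close> at \<open>y\<close>. It is a character
  if \<open>\<zeta>\<^sup>p = \<eta>(y\<^sup>p)\<close>. It is defined through the unique representation \<open>h y\<^sup>j\<close> with \<open>j < p\<close>;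
  \<open>ext_char_eq\<close> removes the bound on \<open>j\<close>.
\<close>

definition ext_char :: "('a \<Rightarrow> complex) \<Rightarrow> complex \<Rightarrow> 'a \<Rightarrow> complex" where
  "ext_char \<eta> \<zeta> = (\<lambda>z\<in>ext. case inv_into (H \<times> {..<p}) (\<lambda>(h, j). h \<otimes> y [^] j) z of
     (h, j) \<Rightarrow> \<eta> h * \<zeta> ^ j)"

lemma ext_char_eq:
  assumes \<eta>: "\<eta> \<in> characters_on G H" and \<zeta>: "\<zeta> ^ p = \<eta> (y [^] p)" and h: "h \<in> H"
  shows "ext_char \<eta> \<zeta> (h \<otimes> y [^] (j::nat)) = \<eta> h * \<zeta> ^ j"
proof -
  define h' where "h' = h \<otimes> (y [^] p) [^] (j div p)"
  have h': "h' \<in> H" using ext_reduce[OF h] by (simp add: h'_def)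
  have "inv_into (H \<times> {..<p}) (\<lambda>(h, j). h \<otimes> y [^] j) (h' \<otimes> y [^] (j mod p)) = (h', j mod p)"
    using inv_into_f_f[OF inj_ext, of "(h', j mod p)"] h' p0 by simp
  then have "ext_char \<eta> \<zeta> (h \<otimes> y [^] j) = \<eta> h' * \<zeta> ^ (j mod p)"
    using ext_reduce(1)[OF h, of j] ext_mem[OF h'] by (simp add: ext_char_def h'_def)
  also have "\<eta> h' = \<eta> h * \<eta> ((y [^] p) [^] (j div p))"
    using \<eta> h subgroup_nat_pow_mem[OF H ypH] by (simp add: h'_def characters_on_def)
  also have "\<eta> ((y [^] p) [^] (j div p)) = \<zeta> ^ (p * (j div p))"
    by (simp add: character_nat_pow[OF H \<eta> ypH] \<zeta> power_mult)
  finally show ?thesis by (simp add: mult.assoc flip: power_add)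
qed

lemma ext_char_mem:
  assumes \<eta>: "\<eta> \<in> characters_on G H" and \<zeta>: "\<zeta> ^ p = \<eta> (y [^] p)"
  shows "ext_char \<eta> \<zeta> \<in> characters_on G ext"
proof -
  have "cmod \<zeta> ^ p = 1" using \<eta> ypH by (simp add: characters_on_def \<zeta> flip: norm_power)
  then have 1: "cmod \<zeta> = 1" using p0 by (auto dest: power_eq_1_iff)
  show ?thesis unfolding characters_on_def
  proof (intro CollectI conjI ballI)
    show "ext_char \<eta> \<zeta> \<in> extensional ext" by (simp add: ext_char_def)
  next
    fix a b assume "a \<in> ext" "b \<in> ext"
    then obtain h i h' j where ab: "a = h \<otimes> y [^] (i::nat)" "h \<in> H" "b = h' \<otimes> y [^] (j::nat)" "h' \<in> H"
      by (metis ext_cases)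
    moreover have "h \<otimes> h' \<in> H" "\<eta> (h \<otimes> h') = \<eta> h * \<eta> h'"
      using ab \<eta> H by (auto simp: subgroup.m_closed characters_on_def)
    ultimately show "ext_char \<eta> \<zeta> (a \<otimes> b) = ext_char \<eta> \<zeta> a * ext_char \<eta> \<zeta> b"
      by (simp add: ext_mult ext_char_eq[OF \<eta> \<zeta>] power_add)
  next
    fix a assume "a \<in> ext"
    then obtain h i where "a = h \<otimes> y [^] (i::nat)" "h \<in> H" by (metis ext_cases)
    then show "cmod (ext_char \<eta> \<zeta> a) = 1"
      using \<eta> by (simp add: ext_char_eq[OF \<eta> \<zeta>] norm_mult norm_power 1 characters_on_def)
  qed
qed

lemma ext_char_inj:
  assumes \<eta>: "\<eta> \<in> characters_on G H" "\<zeta> ^ p = \<eta> (y [^] p)"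
    and \<eta>': "\<eta>' \<in> characters_on G H" "\<zeta>' ^ p = \<eta>' (y [^] p)"
    and eq: "ext_char \<eta> \<zeta> = ext_char \<eta>' \<zeta>'"
  shows "\<eta> = \<eta>'" and "\<zeta> = \<zeta>'"
proof -
  show "\<eta> = \<eta>'"
  proof (rule extensionalityI[of _ H])
    show "\<eta> \<in> extensional H" "\<eta>' \<in> extensional H" using \<eta>(1) \<eta>'(1) by (auto simp: characters_on_def)
    fix h assume h: "h \<in> H"
    show "\<eta> h = \<eta>' h" using ext_char_eq[OF \<eta> h, of 0] ext_char_eq[OF \<eta>' h, of 0] eq by simp
  qed
  have 1: "\<one> \<in> H" using H by (rule subgroup.one_closed)
  show "\<zeta> = \<zeta>'"
    using ext_char_eq[OF \<eta> 1, of 1] ext_char_eq[OF \<eta>' 1, of 1] eq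
      character_one[OF H \<eta>(1)] character_one[OF H \<eta>'(1)] by simp
qed

lemma fourier_ext:
  assumes \<eta>: "\<eta> \<in> characters_on G H" and \<zeta>: "\<zeta> ^ p = \<eta> (y [^] p)"
  shows "fourier_on ext f (ext_char \<eta> \<zeta>)
       = (\<Sum>j<p. fourier_on H (\<lambda>h. f (h \<otimes> y [^] j)) \<eta> * cnj \<zeta> ^ j)"
  unfolding fourier_on_def sum_ext
  by (simp add: ext_char_eq[OF \<eta> \<zeta>] sum_distrib_right mult.assoc)

lemma uncertainty_ext:
  assumes unc: "uncertainty_on G H"
  shows "uncertainty_on G ext"
  unfolding uncertainty_on_def
proof (intro allI impI)
  fix f :: "'a \<Rightarrow> complex"
  assume nz: "\<exists>z\<in>ext. f z \<noteq> 0"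
  define s :: "nat \<Rightarrow> nat" where "s j = card {h \<in> H. f (h \<otimes> y [^] j) \<noteq> 0}" for j
  define T where "T = {j. j < p \<and> (\<exists>h\<in>H. f (h \<otimes> y [^] j) \<noteq> 0)}"
  have finT: "finite T" and T0: "T \<noteq> {}" using nz by (auto simp: T_def ext_def)
  have T: "1 \<le> card T" "card T \<le> p"
    using finT T0 card_mono[of "{..<p}" T] by (auto simp: T_def Suc_le_eq card_gt_0_iff)
  \<comment> \<open>The coset \<open>H y\<^sup>k\<close> meets the support of \<open>f\<close>, and in as few points as possible.\<close>
  obtain k where k: "k \<in> T" "\<And>j. j \<in> T \<Longrightarrow> s k \<le> s j"
    using ex_min_if_finite[of "s ` T"] finT T0
    by (metis (no_types, lifting) arg_min_if_finite(1) arg_min_least)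
  have "card {z \<in> ext. f z \<noteq> 0} = (\<Sum>z\<in>ext. if f z \<noteq> 0 then 1 else 0)"
    using finite_subset[OF subgroup.subset[OF subgroup_ext] finite_G]
    by (simp add: sum.If_cases Int_def)
  also have "\<dots> = (\<Sum>j<p. s j)"
    using finite_H by (simp add: sum_ext s_def sum.If_cases Int_def)
  also have "\<dots> \<ge> (\<Sum>j\<in>T. s j)" by (rule sum_mono2) (auto simp: T_def)
  finally have "(\<Sum>j\<in>T. s j) \<le> card {z \<in> ext. f z \<noteq> 0}" .
  moreover have "card T * s k \<le> (\<Sum>j\<in>T. s j)" using sum_bounded_below[of T "s k" s] k(2) by simp
  ultimately have supp: "s k * card T \<le> card {z \<in> ext. f z \<noteq> 0}" by (simp add: mult.commute)

  define E where "E = {\<eta> \<in> characters_on G H. fourier_on H (\<lambda>h. f (h \<otimes> y [^] k)) \<eta> \<noteq> 0}"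
  have finE: "finite E" using finite_characters_on[OF finite_G H] by (simp add: E_def)
  have domH: "divisor_dominates (card H) (real (s k)) (real (card E))"
    using unc[unfolded uncertainty_on_def, rule_format, of "\<lambda>h. f (h \<otimes> y [^] k)"] k(1)
    by (simp add: s_def E_def T_def)

  define \<omega> where "\<omega> = cis (2 * pi / real p)"
  have \<omega>p: "\<omega> ^ p = 1" using p0 by (simp add: \<omega>_def DeMoivre)
  have \<omega>1: "\<omega> \<noteq> 1"
  proof
    assume "\<omega> = 1"
    have p2: "real p \<ge> 2" using prime_ge_2_nat[OF p] by simp
    have "cos (2 * pi / real p) = 1" using arg_cong[OF \<open>\<omega> = 1\<close>, of Re] by (simp add: \<omega>_def)
    moreover have "cos (2 * pi / real p) < cos 0"
      using p2 by (intro cos_monotone_0_pi) (auto simp: field_simps)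
    ultimately show False by simp
  qed
  have "\<exists>z. z ^ p = \<eta> (y [^] p)" if "\<eta> \<in> characters_on G H" for \<eta>
  proof -
    have "cmod (\<eta> (y [^] p)) = 1" using that ypH by (simp add: characters_on_def)
    moreover from this have "\<eta> (y [^] p) \<noteq> 0" by auto
    ultimately have "cis (Arg (\<eta> (y [^] p)) / real p) ^ p = \<eta> (y [^] p)"
      using p0 cis_Arg[of "\<eta> (y [^] p)"] by (simp add: DeMoivre sgn_eq)
    then show ?thesis by blast
  qed
  \<comment> \<open>One root for each \<open>\<eta>\<close>; the others are its multiples by powers of \<open>\<omega>\<close>.\<close>
  then obtain r where r: "\<And>\<eta>. \<eta> \<in> characters_on G H \<Longrightarrow> r \<eta> ^ p = \<eta> (y [^] p)" by metis
  have r\<omega>: "(r \<eta> * \<omega> ^ i) ^ p = \<eta> (y [^] p)" if "\<eta> \<in> characters_on G H" for \<eta> i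
  proof -
    have "(\<omega> ^ i) ^ p = (\<omega> ^ p) ^ i" by (simp only: power_mult[symmetric] mult.commute)
    then show ?thesis using r[OF that] \<omega>p by (simp add: power_mult_distrib)
  qed
  have r0: "r \<eta> \<noteq> 0" if "\<eta> \<in> characters_on G H" for \<eta>
    using r[OF that] that ypH p0 by (auto simp: characters_on_def power_0_left)
  define X where "X \<eta> i = ext_char \<eta> (r \<eta> * \<omega> ^ i)" for \<eta> i
  define I where "I \<eta> = {i. i < p \<and> fourier_on ext f (X \<eta> i) \<noteq> 0}" for \<eta>
  have card_I: "p + 1 - card T \<le> card (I \<eta>)" if "\<eta> \<in> E" for \<eta>
  proof -
    have \<eta>: "\<eta> \<in> characters_on G H" using that by (simp add: E_def)
    define c where "c j = fourier_on H (\<lambda>h. f (h \<otimes> y [^] j)) \<eta> * cnj (r \<eta>) ^ j" for j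
    have "fourier_on ext f (X \<eta> i) = (\<Sum>j<p. c j * cnj \<omega> ^ (i * j))" for i
      unfolding X_def fourier_ext[OF \<eta> r\<omega>[OF \<eta>]] c_def
      by (simp add: power_mult_distrib power_mult mult.assoc)
    moreover have "p + 1 \<le> card {j. j < p \<and> c j \<noteq> 0}
        + card {i. i < p \<and> (\<Sum>j<p. c j * cnj \<omega> ^ (i * j)) \<noteq> 0}"
    proof (rule prime_uncertainty[OF p])
      show "cnj \<omega> ^ p = 1" using \<omega>p by (metis complex_cnj_one complex_cnj_power)
      show "cnj \<omega> \<noteq> 1" using \<omega>1 by (metis complex_cnj_cnj complex_cnj_one)
      show "\<exists>j<p. c j \<noteq> 0" using that k(1) r0[OF \<eta>] by (intro exI[of _ k]) (auto simp: c_def E_def T_def)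
    qed
    moreover have "c j = 0" if "j < p" "j \<notin> T" for j
      using that by (simp add: T_def c_def fourier_on_def)
    then have "card {j. j < p \<and> c j \<noteq> 0} \<le> card T"
      by (intro card_mono[OF finT]) blast
    ultimately show ?thesis by (simp add: I_def)
  qed
  \<comment> \<open>Distinct pairs \<open>(\<eta>, i)\<close> give distinct characters of the larger group.\<close>
  have "card E * (p + 1 - card T) \<le> (\<Sum>\<eta>\<in>E. card (I \<eta>))"
    using sum_bounded_below[of E "p + 1 - card T" "\<lambda>\<eta>. card (I \<eta>)"] card_I by simp
  also have "\<dots> = card (Sigma E I)" using finE by (simp add: I_def)
  also have "\<dots> = card ((\<lambda>(\<eta>, i). X \<eta> i) ` Sigma E I)"
  proof (rule card_image[symmetric], rule inj_onI, clarify)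
    fix \<eta> \<eta>' i j
    assume a: "\<eta> \<in> E" "\<eta>' \<in> E" "i \<in> I \<eta>" "j \<in> I \<eta>'" "X \<eta> i = X \<eta>' j"
    then have \<eta>: "\<eta> \<in> characters_on G H" "\<eta>' \<in> characters_on G H" by (auto simp: E_def)
    note inj = ext_char_inj[OF \<eta>(1) r\<omega>[OF \<eta>(1)] \<eta>(2) r\<omega>[OF \<eta>(2)] a(5)[unfolded X_def]]
    then have "\<omega> ^ i = \<omega> ^ j" using r0[OF \<eta>(1)] by simp
    then have "i = j"
      using root_of_unity_power_inj[OF p \<omega>p \<omega>1] a by (auto simp: I_def inj_on_def)
    then show "\<eta> = \<eta>' \<and> i = j" using inj by simp
  qed
  also have "\<dots> \<le> card {\<chi> \<in> characters_on G ext. fourier_on ext f \<chi> \<noteq> 0}"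
    using finite_characters_on[OF finite_G subgroup_ext] ext_char_mem r\<omega>
    by (intro card_mono) (auto simp: E_def I_def X_def)
  finally have four: "card E * (p + 1 - card T) \<le> card {\<chi> \<in> characters_on G ext. fourier_on ext f \<chi> \<noteq> 0}" .

  have "divisor_dominates (card H * p) (real (s k) * real (card T)) (real (card E) * real (p + 1 - card T))"
    using T by (intro divisor_dominates_mult[OF domH] divisor_dominates_prime p) auto
  then show "divisor_dominates (card ext) (real (card {z \<in> ext. f z \<noteq> 0}))
      (real (card {\<chi> \<in> characters_on G ext. fourier_on ext f \<chi> \<noteq> 0}))"
    unfolding card_ext using supp four
    by (elim divisor_dominates_mono) (simp_all only: of_nat_le_iff flip: of_nat_mult)
qed

end

section \<open>Uncertainty principle for finite abelian groups\<close>

lemma (in group) uncertainty_trivial: "uncertainty_on G {\<one>}"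
  unfolding uncertainty_on_def
proof (intro allI impI)
  fix f :: "'a \<Rightarrow> complex" assume "\<exists>h\<in>{\<one>}. f h \<noteq> 0"
  then have f: "f \<one> \<noteq> 0" by simp
  have "characters_on G {\<one>} = {\<lambda>x\<in>{\<one>}. 1}"
    using character_one[OF triv_subgroup]
    by (auto simp: characters_on_def extensional_def fun_eq_iff)
  then have "{\<chi> \<in> characters_on G {\<one>}. fourier_on {\<one>} f \<chi> \<noteq> 0} = {\<lambda>x\<in>{\<one>}. 1}"
    using f by (auto simp: fourier_on_def)
  moreover have "{h \<in> {\<one>}. f h \<noteq> 0} = {\<one>}" using f by auto
  ultimately show "divisor_dominates (card {\<one>}) (real (card {h \<in> {\<one>}. f h \<noteq> 0}))
     (real (card {\<chi> \<in> characters_on G {\<one>}. fourier_on {\<one>} f \<chi> \<noteq> 0}))"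
    by (simp add: divisor_dominates_def)
qed

lemma (in group) exists_prime_power_in_subgroup:
  assumes fin: "finite (carrier G)" and H: "subgroup H G" and x: "x \<in> carrier G" "x \<notin> H"
  obtains p y where "prime (p::nat)" "y \<in> carrier G" "y [^] p \<in> H"
    "\<And>j. 0 < j \<Longrightarrow> j < p \<Longrightarrow> y [^] j \<notin> H"
proof -
  \<comment> \<open>The order of \<open>x\<close> modulo \<open>H\<close>.\<close>
  define m where "m = (LEAST m. 0 < m \<and> x [^] (m::nat) \<in> H)"
  have "0 < order G \<and> x [^] order G \<in> H"
    using fin x(1) subgroup.one_closed[OF H] by (simp add: order_gt_0_iff_finite pow_order_eq_1)
  then have m: "0 < m" "x [^] m \<in> H" unfolding m_def
    using LeastI[of "\<lambda>m. 0 < m \<and> x [^] m \<in> H" "order G"] by blast+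
  have least: "x [^] j \<notin> H" if "0 < j" "j < m" for j
    using not_less_Least[of j "\<lambda>m. 0 < m \<and> x [^] m \<in> H"] that by (auto simp: m_def)
  have "m \<noteq> 1" using m x by auto
  then obtain p where p: "prime p" "p dvd m" using prime_factor_nat by blast
  then obtain q where q: "m = q * p" by (auto elim: dvdE simp: mult.commute)
  have q0: "0 < q" using m q by auto
  show thesis
  proof
    show "prime p" "x [^] q \<in> carrier G" using p x by auto
    show "(x [^] q) [^] p \<in> H" using m x by (simp add: nat_pow_pow q)
    show "(x [^] q) [^] j \<notin> H" if "0 < j" "j < p" for j
      using least[of "q * j"] that q0 q x by (simp add: nat_pow_pow)
  qed
qed

theorem (in comm_group) uncertainty_carrier:
  assumes fin: "finite (carrier G)"
  shows "uncertainty_on G (carrier G)"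
proof -
  define \<H> where "\<H> = {H. subgroup H G \<and> uncertainty_on G H}"
  have "finite \<H>"
    by (rule finite_subset[of _ "Pow (carrier G)"]) (auto simp: \<H>_def fin dest: subgroup.subset)
  moreover have "{\<one>} \<in> \<H>" by (simp add: \<H>_def triv_subgroup uncertainty_trivial)
  ultimately obtain H where mem: "H \<in> \<H>" and max: "\<And>K. K \<in> \<H> \<Longrightarrow> H \<subseteq> K \<Longrightarrow> K = H"
    using finite_has_maximal[of \<H>] by (metis empty_iff)
  have sub: "subgroup H G" using mem by (simp add: \<H>_def)
  have "H = carrier G"
  proof (rule ccontr)
    assume "H \<noteq> carrier G"
    then obtain x where x: "x \<in> carrier G" "x \<notin> H" using subgroup.subset[OF sub] by blast
    obtain p y where py: "prime (p::nat)" "y \<in> carrier G" "y [^] p \<in> H"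
      "\<And>j. 0 < j \<Longrightarrow> j < p \<Longrightarrow> y [^] j \<notin> H"
      using exists_prime_power_in_subgroup[OF fin sub x] by blast
    interpret prime_cyclic_extension G H p y
      by (intro prime_cyclic_extension.intro prime_cyclic_extension_axioms.intro comm_group_axioms
          fin sub py)
    have "uncertainty_on G ext" using mem by (intro uncertainty_ext) (simp add: \<H>_def)
    then have "ext \<in> \<H>" using subgroup_ext by (simp add: \<H>_def)
    then have "ext = H" using H_subset_ext by (rule max)
    then have "y [^] (1::nat) \<in> H" using y_mem_ext y by simp
    then show False using yjH[of 1] prime_gt_1_nat[OF p] by simp
  qed
  then show ?thesis using mem by (simp add: \<H>_def)
qed

section \<open>Short-time Fourier transform with a constant window\<close>

lemma norm0_stft_const:
  fixes G :: "('a, 'b) monoid_scheme"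
  assumes "group G" and "finite (carrier G)"
  shows "norm0 (carrier G \<times> carrier (dual_group G)) (stft G (\<lambda>x\<in>carrier G. 1) f)
       = order G * card {\<chi> \<in> characters_on G (carrier G). fourier_on (carrier G) f \<chi> \<noteq> 0}"
proof -
  interpret group G by fact
  have "stft G (\<lambda>x\<in>carrier G. 1) f (x, \<xi>) = fourier_on (carrier G) f \<xi>"
    if "x \<in> carrier G" "\<xi> \<in> carrier (dual_group G)" for x \<xi>
    using that by (simp add: stft_def fourier_on_def)
  then have "{a \<in> carrier G \<times> carrier (dual_group G). stft G (\<lambda>x\<in>carrier G. 1) f a \<noteq> 0}
     = carrier G \<times> {\<chi> \<in> characters_on G (carrier G). fourier_on (carrier G) f \<chi> \<noteq> 0}"
    by (auto simp: carrier_dual_group)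
  then show ?thesis by (simp add: norm0_def card_cartesian_product Coset.order_def)
qed

text \<open>
  Each window \<open>g\<close> bounds \<open>\<phi>(G, k)\<close> from below by a minimum over \<open>f\<close>, which is attained. The sizes
  of supports are bounded and some \<open>f\<close> is admissible, so that all these minima and their maximum exist.
\<close>

lemma stft_phi_attained:
  fixes G :: "('a, 'b) monoid_scheme"
  assumes "group G" and fin: "finite (carrier G)" and "1 \<le> k"
    and g: "g \<in> complex_funs (carrier G) - {\<lambda>x\<in>carrier G. 0}"
  obtains f where "f \<in> complex_funs (carrier G)" "0 < norm0 (carrier G) f" "norm0 (carrier G) f \<le> k"
    "norm0 (carrier G \<times> carrier (dual_group G)) (stft G g f) \<le> stft_phi G k"
proof -
  interpret group G by fact
  define A where "A = carrier G \<times> carrier (dual_group G)"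
  define V where "V g = {norm0 A (stft G g f) | f. f \<in> complex_funs (carrier G) \<and>
                 0 < norm0 (carrier G) f \<and> norm0 (carrier G) f \<le> k}" for g
  have finA: "finite A"
    using finite_characters_on[OF fin subgroup_self] fin by (simp add: A_def carrier_dual_group)
  have V: "V g \<subseteq> {..card A}" for g
    using finA by (auto simp: V_def norm0_def intro!: card_mono)
  have finV: "finite (V g)" for g using V by (rule finite_subset) simp
  define \<delta> :: "'a \<Rightarrow> complex" where "\<delta> = (\<lambda>x\<in>carrier G. if x = \<one>\<^bsub>G\<^esub> then 1 else 0)"
  have "{a \<in> carrier G. \<delta> a \<noteq> 0} = {\<one>\<^bsub>G\<^esub>}" by (auto simp: \<delta>_def)
  then have "norm0 (carrier G) \<delta> = 1" by (simp add: norm0_def)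
  then have V0: "V g \<noteq> {}" for g
    using \<open>1 \<le> k\<close> by (auto simp: V_def complex_funs_def \<delta>_def intro!: exI[of _ \<delta>])
  have MinV: "Min (V g) \<in> V g" for g using finV V0 by (rule Min_in)
  have "finite {Min (V g) | g. g \<in> complex_funs (carrier G) - {\<lambda>x\<in>carrier G. 0}}"
  proof (rule finite_subset)
    show "{Min (V g) | g. g \<in> complex_funs (carrier G) - {\<lambda>x\<in>carrier G. 0}} \<subseteq> {..card A}"
      using subsetD[OF V MinV] by auto
  qed simp
  then have "Min (V g) \<le> stft_phi G k"
    unfolding stft_phi_def V_def[symmetric] A_def[symmetric] 
    by (rule Max_ge) (use g in blast)
  moreover obtain f where "Min (V g) = norm0 A (stft G g f)" "f \<in> complex_funs (carrier G)"
    "0 < norm0 (carrier G) f" "norm0 (carrier G) f \<le> k"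
    using MinV[of g] unfolding V_def by blast
  ultimately show thesis using that by (simp add: A_def)
qed

theorem theorem4p12:
  fixes G :: "('a, 'b) monoid_scheme" and k d1 d2 :: nat
  assumes "comm_group G" and "finite (carrier G)"
    and "1 \<le> k" and "k \<le> order G"
    and "d1 = Max {d. d dvd order G \<and> d \<le> k}"
    and "d2 = Min {d. d dvd order G \<and> k \<le> d}"
  shows "real (stft_phi G k) \<ge>
           (real (order G))\<^sup>2 / (real d1 * real d2) * (real d1 + real d2 - real k)"
proof -
  interpret comm_group G by fact
  define n where "n = order G"
  have n0: "n > 0" using assms(3,4) by (simp add: n_def)
  have fin1: "finite {d. d dvd n \<and> d \<le> k}" and fin2: "finite {d. d dvd n \<and> k \<le> d}"
    using n0 finite_divisors_nat[of n] by auto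
  have one_mem: "1 \<in> {d. d dvd n \<and> d \<le> k}" and n_mem: "n \<in> {d. d dvd n \<and> k \<le> d}"
    using assms(3,4) by (auto simp: n_def)
  have "1 \<le> d1" unfolding assms(5) n_def[symmetric] by (rule Max_ge[OF fin1 one_mem])
  moreover have "d1 \<in> {d. d dvd n \<and> d \<le> k}"
    unfolding assms(5) n_def[symmetric] by (rule Max_in[OF fin1]) (use one_mem in blast)
  moreover have "d2 \<in> {d. d dvd n \<and> k \<le> d}"
    unfolding assms(6) n_def[symmetric] by (rule Min_in[OF fin2]) (use n_mem in blast)
  ultimately have d: "1 \<le> d1" "d1 \<le> k" "k \<le> d2" by auto
  have gap: "D \<le> d1 \<or> d2 \<le> D" if "D dvd n" for D
  proof (cases "D \<le> k")
    case True
    then show ?thesis unfolding assms(5) n_def[symmetric] using that Max_ge[OF fin1, of D] by simp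
  next
    case False
    then show ?thesis unfolding assms(6) n_def[symmetric] using that Min_le[OF fin2, of D] by simp
  qed
  define g :: "'a \<Rightarrow> complex" where "g = (\<lambda>x\<in>carrier G. 1)"
  have "g \<one>\<^bsub>G\<^esub> \<noteq> (\<lambda>x\<in>carrier G. 0) \<one>\<^bsub>G\<^esub>" by (simp add: g_def)
  then have "g \<noteq> (\<lambda>x\<in>carrier G. 0)" by auto
  moreover have "g \<in> complex_funs (carrier G)" by (simp add: g_def complex_funs_def)
  ultimately have "g \<in> complex_funs (carrier G) - {\<lambda>x\<in>carrier G. 0}" by simp
  then obtain f where f: "0 < norm0 (carrier G) f" "norm0 (carrier G) f \<le> k"
    and phi: "norm0 (carrier G \<times> carrier (dual_group G)) (stft G g f) \<le> stft_phi G k"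
    using stft_phi_attained[OF is_group assms(2,3)] by metis
  define N where "N = card {\<chi> \<in> characters_on G (carrier G). fourier_on (carrier G) f \<chi> \<noteq> 0}"
  have phi': "real n * real N \<le> real (stft_phi G k)"
    using phi norm0_stft_const[OF is_group assms(2), of f]
    by (simp add: g_def N_def n_def flip: of_nat_mult)
  have "\<exists>h\<in>carrier G. f h \<noteq> 0" using f(1) assms(2) by (auto simp: norm0_def card_gt_0_iff)
  then have "divisor_dominates n (real (norm0 (carrier G) f)) (real N)"
    using uncertainty_carrier[OF assms(2)]
    unfolding uncertainty_on_def norm0_def n_def Coset.order_def N_def by blast
  then have "divisor_dominates n (real k) (real N)"
    using f(2) by (auto elim: divisor_dominates_mono)
  then have "real n * (real d1 + real d2) \<le> real n * real k + real d1 * real d2 * real N"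
    using n0 gap d by (intro divisor_dominates_chord) auto
  then have "real n * (real d1 + real d2 - real k) \<le> real d1 * real d2 * real N"
    by (simp add: algebra_simps)
  then have "real n * (real d1 + real d2 - real k) / (real d1 * real d2) \<le> real N"
    using d by (simp add: divide_le_eq mult_ac)
  then have "real n * (real n * (real d1 + real d2 - real k) / (real d1 * real d2)) \<le> real n * real N"
    by (intro mult_left_mono) auto
  also note phi'
  finally show ?thesis by (simp add: n_def power2_eq_square mult_ac)
qed

end
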